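(* Let $L$ be a $BL$-algebra and $F:L\to[0,1]$ a fuzzy set. Then $F$ is an $(\overline{\in},\overline{\in}\vee\overline{q})$-fuzzy implicative filter of $L$ if and only if for every $t\in(0.5,1]$ for which $U(F;t)=\{x\in L\mid F(x)\ge t\}$ is non-empty, $U(F;t)$ is an implicative filter of $L$.
   Context: A $BL$-algebra is an algebra $(L,\le,\wedge,\vee,\odot,\rightarrow,0,1)$ that is a bounded lattice (least element $0$, greatest element $1$) such that $(L,\odot,1)$ is a commutative monoid, $z\le x\rightarrow y$ iff $x\odot z\le y$, $x\wedge y=x\odot(x\rightarrow y)$, and $(x\rightarrow y)\vee(y\rightarrow x)=1$, for all $x,y,z\in L$. Write $x'=x\rightarrow 0$. A filter of $L$ is a non-empty subset $A\subseteq L$ with $1\in A$ such that $x\in A$ and $x\rightarrow y\in A$ imply $y\in A$; it is implicative if $x\rightarrow(z'\rightarrow y)\in A$ and $y\rightarrow z\in A$ imply $x\rightarrow z\in A$ for all $x,y,z$. For $x\in L$ and $t\in(0,1]$, the fuzzy point $U(x;t)$ is said to belong to $F$, written $U(x;t)\in F$, if $F(x)\ge t$, and to be quasi-coincident with $F$, written $U(x;t)\,q\,F$, if $F(x)+t>1$; $\overline{\in}$ and $\overline{q}$ denote the negations of these relations, and $U(x;t)\,\overline{\in}\vee\overline{q}\,F$ means $U(x;t)\,\overline{\in}\,F$ or $U(x;t)\,\overline{q}\,F$. A fuzzy set $F$ is an $(\overline{\in},\overline{\in}\vee\overline{q})$-fuzzy filter of $L$ if for all $t,r\in(0,1]$ and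 $x,y\in L$: (i) if $U(x\odot y;\min\{t,r\})\,\overline{\in}\,F$ then $U(x;t)\,\overline{\in}\vee\overline{q}\,F$ or $U(y;r)\,\overline{\in}\vee\overline{q}\,F$; (ii) if $x\le y$ and $U(y;r)\,\overline{\in}\,F$ then $U(x;r)\,\overline{\in}\vee\overline{q}\,F$. It is an $(\overline{\in},\overline{\in}\vee\overline{q})$-fuzzy implicative filter if moreover $\max\{F(x\rightarrow z),0.5\}\ge\min\{F(x\rightarrow(z'\rightarrow y)),F(y\rightarrow z)\}$ for all $x,y,z\in L$. *)

theory Defs
  imports Complex_Main
begin

text \<open>The least element 0 and the greatest element 1 of a BL-algebra are the library's
  \<open>bot\<close> and \<open>top\<close>; the unit of the monoid is \<open>top\<close>.\<close>

class bl_algebra = bounded_lattice +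
  fixes bl_mult :: "'a \<Rightarrow> 'a \<Rightarrow> 'a"  (infixl \<open>\<^bold>\<odot>\<close> 75)
    and bl_imp :: "'a \<Rightarrow> 'a \<Rightarrow> 'a"  (infixr \<open>\<^bold>\<rightarrow>\<close> 70)
  assumes bl_mult_assoc: "(x \<^bold>\<odot> y) \<^bold>\<odot> z = x \<^bold>\<odot> (y \<^bold>\<odot> z)"
    and bl_mult_commute: "x \<^bold>\<odot> y = y \<^bold>\<odot> x"
    and bl_mult_top: "x \<^bold>\<odot> top = x"
    and bl_residuation: "z \<le> x \<^bold>\<rightarrow> y \<longleftrightarrow> x \<^bold>\<odot> z \<le> y"
    and bl_divisibility: "inf x y = x \<^bold>\<odot> (x \<^bold>\<rightarrow> y)"
    and bl_prelinearity: "sup (x \<^bold>\<rightarrow> y) (y \<^bold>\<rightarrow> x) = top"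

definition bl_neg :: "'a::bl_algebra \<Rightarrow> 'a" where
  "bl_neg x = x \<^bold>\<rightarrow> bot"

definition bl_filter :: "'a::bl_algebra set \<Rightarrow> bool" where
  "bl_filter A \<longleftrightarrow> A \<noteq> {} \<and> top \<in> A \<and> (\<forall>x y. x \<in> A \<and> x \<^bold>\<rightarrow> y \<in> A \<longrightarrow> y \<in> A)"

definition implicative_filter :: "'a::bl_algebra set \<Rightarrow> bool" where
  "implicative_filter A \<longleftrightarrow> bl_filter A \<and>
     (\<forall>x y z. x \<^bold>\<rightarrow> (bl_neg z \<^bold>\<rightarrow> y) \<in> A \<and> y \<^bold>\<rightarrow> z \<in> A \<longrightarrow> x \<^bold>\<rightarrow> z \<in> A)"

definition fuzzy_set :: "('a \<Rightarrow> real) \<Rightarrow> bool" where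
  "fuzzy_set F \<longleftrightarrow> (\<forall>x. 0 \<le> F x \<and> F x \<le> 1)"

text \<open>A fuzzy point \<open>U(x;t)\<close> is represented by its support \<open>x\<close> and its value \<open>t\<close>.\<close>

definition point_in :: "'a \<Rightarrow> real \<Rightarrow> ('a \<Rightarrow> real) \<Rightarrow> bool" where
  "point_in x t F \<longleftrightarrow> F x \<ge> t"

definition point_q :: "'a \<Rightarrow> real \<Rightarrow> ('a \<Rightarrow> real) \<Rightarrow> bool" where
  "point_q x t F \<longleftrightarrow> F x + t > 1"

definition point_notin_or_notq :: "'a \<Rightarrow> real \<Rightarrow> ('a \<Rightarrow> real) \<Rightarrow> bool" where
  "point_notin_or_notq x t F \<longleftrightarrow> \<not> point_in x t F \<or> \<not> point_q x t F"

text \<open>Only one kind of fuzzy filter occurs here, so the names below omit the prefix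
  (not in, not in or not quasi-coincident).\<close>

definition fuzzy_filter :: "('a::bl_algebra \<Rightarrow> real) \<Rightarrow> bool" where
  "fuzzy_filter F \<longleftrightarrow>
     (\<forall>t\<in>{0<..1}. \<forall>r\<in>{0<..1}. \<forall>x y.
        (\<not> point_in (x \<^bold>\<odot> y) (min t r) F \<longrightarrow>
           point_notin_or_notq x t F \<or> point_notin_or_notq y r F) \<and>
        (x \<le> y \<and> \<not> point_in y r F \<longrightarrow> point_notin_or_notq x r F))"

definition fuzzy_implicative_filter :: "('a::bl_algebra \<Rightarrow> real) \<Rightarrow> bool" where
  "fuzzy_implicative_filter F \<longleftrightarrow> fuzzy_filter F \<and>
     (\<forall>x y z. max (F (x \<^bold>\<rightarrow> z)) (1/2) \<ge> min (F (x \<^bold>\<rightarrow> (bl_neg z \<^bold>\<rightarrow> y))) (F (y \<^bold>\<rightarrow> z)))"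

definition level_set :: "('a \<Rightarrow> real) \<Rightarrow> real \<Rightarrow> 'a set" where
  "level_set F t = {x. F x \<ge> t}"

end

theory Submission imports Defs begin

text \<open>Eliminating the points \<open>t\<close>, \<open>r\<close> turns each fuzzy condition into an inequality
  of the form \<open>m \<le> max c (1/2)\<close> between values of \<open>F\<close>, and such an inequality says
  precisely that every level \<open>t > 1/2\<close> reached by \<open>m\<close> is reached by \<open>c\<close>. Since filters are
  the non-empty up-sets closed under multiplication, these are the closure properties of the
  level sets.\<close>

lemma bl_imp_eq_top_iff:
  fixes x y :: "'a::bl_algebra"
  shows "x \<^bold>\<rightarrow> y = top \<longleftrightarrow> x \<le> y"
  using bl_residuation[of top x y] by (simp add: bl_mult_top top_unique)

lemma bl_filter_iff_upset_mult_closed: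
  fixes A :: "'a::bl_algebra set"
  shows "bl_filter A \<longleftrightarrow> A \<noteq> {} \<and> (\<forall>x y. x \<in> A \<and> y \<in> A \<longrightarrow> x \<^bold>\<odot> y \<in> A)
    \<and> (\<forall>x y. x \<le> y \<and> x \<in> A \<longrightarrow> y \<in> A)" (is "_ \<longleftrightarrow> ?R")
proof
  assume A: "bl_filter A"
  have up: "y \<in> A" if "x \<le> y" "x \<in> A" for x y
  proof -
    have "x \<^bold>\<rightarrow> y \<in> A"
      using A that(1) by (simp add: bl_filter_def bl_imp_eq_top_iff[THEN iffD2])
    then show ?thesis
      using A that(2) unfolding bl_filter_def by blast
  qed
  have "x \<^bold>\<odot> y \<in> A" if "x \<in> A" "y \<in> A" for x y
  proof -
    have "x \<le> y \<^bold>\<rightarrow> x \<^bold>\<odot> y"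
      by (simp add: bl_residuation bl_mult_commute)
    then have "y \<^bold>\<rightarrow> x \<^bold>\<odot> y \<in> A"
      using up that(1) by blast
    then show ?thesis
      using A that(2) unfolding bl_filter_def by blast
  qed
  then show ?R
    using A up unfolding bl_filter_def by blast
next
  assume R: ?R
  have "y \<in> A" if "x \<in> A" "x \<^bold>\<rightarrow> y \<in> A" for x y
  proof -
    have "x \<^bold>\<odot> (x \<^bold>\<rightarrow> y) \<le> y"
      using bl_residuation[of "x \<^bold>\<rightarrow> y" x y] by simp
    then show ?thesis
      using R that by blast
  qed
  moreover have "A \<noteq> {}" "top \<in> A"
    using R top_greatest by blast+
  ultimately show "bl_filter A"
    unfolding bl_filter_def by blast
qed

text \<open>If \<open>m\<close> > 1/2, the level \<open>t = m\<close> is admissible by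
  \<open>m\<close> \<le> 1 and is the decisive one; if \<open>m\<close> \<le> 1/2, both sides hold
  trivially.\<close>

lemma le_max_half_iff_levels:
  fixes m c :: real
  assumes "m \<le> 1"
  shows "m \<le> max c (1/2) \<longleftrightarrow> (\<forall>t\<in>{1/2<..1}. t \<le> m \<longrightarrow> t \<le> c)"
proof
  assume "\<forall>t\<in>{1/2<..1}. t \<le> m \<longrightarrow> t \<le> c"
  then show "m \<le> max c (1/2)"
    using assms by (cases "m > 1/2") auto
qed auto

text \<open>The bound 1/2 comes from combining the two relations: \<open>t\<close> \<le>
  \<open>F x\<close> and \<open>F x + t\<close> > 1 force \<open>F x\<close> > 1/2, and at height
  \<open>t = F x\<close> they amount to exactly that.\<close>

lemma fuzzy_filter_iff_le_max_half:
  assumes "fuzzy_set F"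
  shows "fuzzy_filter F \<longleftrightarrow>
    (\<forall>x y. min (F x) (F y) \<le> max (F (x \<^bold>\<odot> y)) (1/2)) \<and>
    (\<forall>x y. x \<le> y \<longrightarrow> F x \<le> max (F y) (1/2))" (is "_ \<longleftrightarrow> ?M \<and> ?U")
proof
  assume F: "fuzzy_filter F"
  have le1: "F x \<le> 1" for x
    using assms unfolding fuzzy_set_def by blast
  have ?M
  proof (rule ccontr)
    assume "\<not> ?M"
    then obtain x y where xy: "min (F x) (F y) > max (F (x \<^bold>\<odot> y)) (1/2)"
      by (auto simp: not_le)
    \<comment> \<open>The violation makes \<open>s\<close> > 1/2, so the points of height
      \<open>s\<close> at \<open>x\<close> and \<open>y\<close> both belong to \<open>F\<close> and
      are quasi-coincident with it, while \<open>s\<close> exceeds the value at the product.\<close>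
    define s where "s = min (F x) (F y)"
    have "s \<in> {0<..1}"
      using xy le1[of x] by (auto simp: s_def)
    with F have "\<not> point_in (x \<^bold>\<odot> y) (min s s) F \<longrightarrow>
        point_notin_or_notq x s F \<or> point_notin_or_notq y s F"
      unfolding fuzzy_filter_def by blast
    with xy show False
      by (auto simp: point_notin_or_notq_def point_in_def point_q_def s_def min_def split: if_splits)
  qed
  moreover have ?U
  proof (rule ccontr)
    assume "\<not> ?U"
    then obtain x y where xy: "x \<le> y" "F x > max (F y) (1/2)"
      by (auto simp: not_le)
    \<comment> \<open>The height \<open>F x\<close> > 1/2 plays the role of \<open>s\<close>
      above.\<close>
    then have "F x \<in> {0<..1}"
      using le1[of x] by auto
    with F xy(1) have "\<not> point_in y (F x) F \<longrightarrow> point_notin_or_notq x (F x) F"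
      unfolding fuzzy_filter_def by blast
    with xy(2) show False
      by (auto simp: point_notin_or_notq_def point_in_def point_q_def)
  qed
  ultimately show "?M \<and> ?U" ..
next
  assume R: "?M \<and> ?U"
  show "fuzzy_filter F"
    unfolding fuzzy_filter_def
  proof (intro ballI allI conjI impI)
    fix t r x y
    assume "\<not> point_in (x \<^bold>\<odot> y) (min t r) F"
    moreover have "min (F x) (F y) \<le> max (F (x \<^bold>\<odot> y)) (1/2)"
      using R by blast
    \<comment> \<open>Otherwise \<open>F x\<close> and \<open>F y\<close> both exceed 1/2 and their
      minimum is at least \<open>min t r\<close>, which is greater than the value at the product;
      this contradicts the inequality.\<close>
    ultimately show "point_notin_or_notq x t F \<or> point_notin_or_notq y r F"
      unfolding point_notin_or_notq_def point_in_def point_q_def by linarith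
  next
    fix r x y
    assume "x \<le> y \<and> \<not> point_in y r F"
    moreover from this have "F x \<le> max (F y) (1/2)"
      using R by blast
    ultimately show "point_notin_or_notq x r F"
      unfolding point_notin_or_notq_def point_in_def point_q_def by linarith
  qed
qed

theorem theorem3p1p4:
  fixes F :: "'a::bl_algebra \<Rightarrow> real"
  assumes "fuzzy_set F"
  shows "fuzzy_implicative_filter F \<longleftrightarrow>
    (\<forall>t\<in>{1/2<..1}. level_set F t \<noteq> {} \<longrightarrow> implicative_filter (level_set F t))"
proof -
  have le1: "F x \<le> 1" for x
    using assms unfolding fuzzy_set_def by blast
  have min_le1: "min (F x) (F y) \<le> 1" for x y
    using le1[of x] by linarith
  have "fuzzy_implicative_filter F \<longleftrightarrow>
    (\<forall>t\<in>{1/2<..1}. (\<forall>x y. t \<le> F x \<and> t \<le> F y \<longrightarrow> t \<le> F (x \<^bold>\<odot> y)) \<and>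
      (\<forall>x y. x \<le> y \<and> t \<le> F x \<longrightarrow> t \<le> F y) \<and>
      (\<forall>x y z. t \<le> F (x \<^bold>\<rightarrow> (bl_neg z \<^bold>\<rightarrow> y)) \<and> t \<le> F (y \<^bold>\<rightarrow> z) \<longrightarrow> t \<le> F (x \<^bold>\<rightarrow> z)))"
    (is "_ \<longleftrightarrow> (\<forall>t\<in>_. ?C t)")
  proof -
    have "(\<forall>x y. min (F x) (F y) \<le> max (F (x \<^bold>\<odot> y)) (1/2)) \<longleftrightarrow>
      (\<forall>t\<in>{1/2<..1}. \<forall>x y. t \<le> F x \<and> t \<le> F y \<longrightarrow> t \<le> F (x \<^bold>\<odot> y))"
      unfolding le_max_half_iff_levels[OF min_le1] min.bounded_iff by blast
    moreover have "(\<forall>x y. x \<le> y \<longrightarrow> F x \<le> max (F y) (1/2)) \<longleftrightarrow>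
      (\<forall>t\<in>{1/2<..1}. \<forall>x y. x \<le> y \<and> t \<le> F x \<longrightarrow> t \<le> F y)"
      unfolding le_max_half_iff_levels[OF le1] by blast
    \<comment> \<open>The implicative condition is already an inequality, so the level criterion
      applies to it directly.\<close>
    moreover have "(\<forall>x y z. max (F (x \<^bold>\<rightarrow> z)) (1/2) \<ge>
        min (F (x \<^bold>\<rightarrow> (bl_neg z \<^bold>\<rightarrow> y))) (F (y \<^bold>\<rightarrow> z))) \<longleftrightarrow>
      (\<forall>t\<in>{1/2<..1}. \<forall>x y z.
        t \<le> F (x \<^bold>\<rightarrow> (bl_neg z \<^bold>\<rightarrow> y)) \<and> t \<le> F (y \<^bold>\<rightarrow> z) \<longrightarrow> t \<le> F (x \<^bold>\<rightarrow> z))"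
      unfolding le_max_half_iff_levels[OF min_le1] min.bounded_iff by blast
    ultimately show ?thesis
      unfolding fuzzy_implicative_filter_def fuzzy_filter_iff_le_max_half[OF assms]
        ball_conj_distrib conj_assoc by (simp only:)
  qed
  \<comment> \<open>Every clause of \<open>?C t\<close> is vacuous on an empty level set, which
    accounts for the non-emptiness guard on the right.\<close>
  moreover have "?C t \<longleftrightarrow> (level_set F t \<noteq> {} \<longrightarrow> implicative_filter (level_set F t))" for t
    unfolding implicative_filter_def bl_filter_iff_upset_mult_closed level_set_def
    by auto
  ultimately show ?thesis
    by simp
qed

end
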